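(* Let $\sigma=(2,3,4,\ldots)$, i.e. $\sigma=(b_1,b_2,\ldots)$ with $b_n=n+1$ for $n\ge 1$. If $p$ and $q$ are integers with $q\ne 0$, then $$\left|e-\frac{p}{q}\right| > \frac{1}{(D(q,\sigma)+2)!}.$$
   Context: Here $\mathbb{N}=\{1,2,3,\ldots\}$ and $e$ is the base of the natural logarithm. For a sequence $\sigma=(b_1,b_2,\ldots)$ of positive integers such that every prime divides infinitely many of the $b_n$, and a nonzero integer $q$, $D(q,\sigma):=\min\{n\in\mathbb{N} : q\mid b_1b_2\cdots b_n\}$. For $\sigma=(2,3,4,\ldots)$ one has $b_1\cdots b_n=(n+1)!$, so $D(q,\sigma)$ is the smallest integer $n\ge 1$ such that $q\mid (n+1)!$. *)

theory Defs
  imports Complex_Main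
begin

text \<open>A sequence $(b_1, b_2, \ldots)$ of positive integers is a function on the naturals of which
  only the values at indices $n \ge 1$ are used; the value at 0 is irrelevant.
  \<open>D\<close> is a genuine minimum when every prime divides infinitely many
  of the $b_n$ and $q$ is nonzero; otherwise it may be a junk value.\<close>

definition D :: "int \<Rightarrow> (nat \<Rightarrow> nat) \<Rightarrow> nat"
  where "D q b = (LEAST n. 1 \<le> n \<and> q dvd (\<Prod>i=1..n. int (b i)))"

definition sigma :: "nat \<Rightarrow> nat"
  where "sigma n = n + 1"

lemma prod_sigma: "(\<Prod>i=1..n. int (sigma i)) = fact (n + 1)"
  by (induction n) (simp_all add: sigma_def algebra_simps)

text \<open>Hence the minimum defining \<^term>\<open>D q sigma\<close> is attained for nonzero \<^term>\<open>q\<close>.\<close>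

lemma D_sigma_exists:
  assumes "q \<noteq> 0"
  shows "\<exists>n\<ge>1. q dvd (\<Prod>i=1..n. int (sigma i))"
proof (intro exI conjI)
  have pos: "1 \<le> nat \<bar>q\<bar>" using assms by linarith
  then show "1 \<le> nat \<bar>q\<bar>" .
  have "nat \<bar>q\<bar> dvd fact (nat \<bar>q\<bar> + 1)"
    using pos by (intro dvd_fact) auto
  then have "int (nat \<bar>q\<bar>) dvd int (fact (nat \<bar>q\<bar> + 1))"
    by (simp only: int_dvd_int_iff)
  then show "q dvd (\<Prod>i=1..nat \<bar>q\<bar>. int (sigma i))"
    unfolding prod_sigma by (simp only: of_nat_fact int_nat_eq) (simp del: fact_Suc)
qed

end

theory Submission
  imports Defs
begin

text \<open>If \<open>q\<close> divides \<open>N!\<close> with \<open>N \<ge> 2\<close>, then \<open>N! p / q\<close> is an integer. Taylor's formula with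
  Lagrange remainder at order \<open>N + 2\<close> places \<open>N! e\<close> strictly more than \<open>1 / (N + 1)\<close> away from
  both neighbouring integers; divide by \<open>N!\<close>. Here \<open>N = D(q, \<sigma>) + 1\<close>.\<close>

lemma fact_times_exp_1:
  fixes N :: nat
  assumes "N \<ge> 2"
  obtains A :: int and s :: real
  where "fact N * exp 1 = real_of_int A + s"
    and "1 / real (N + 1) < s" and "s < 1 - 1 / real (N + 1)"
proof -
  \<comment> \<open>The order exceeds \<open>N + 1\<close> so that, after scaling by
    \<open>fact N\<close>, the term for \<open>k = N + 1\<close> contributes exactly 1/(N+1). The
    remainder need only be positive for a strict lower bound, which holds even if \<open>t\<close>
    is negative.\<close>
  obtain t :: real where t: "\<bar>t\<bar> \<le> 1"
    and exp_eq: "exp 1 = (\<Sum>k<N + 2. 1 / fact k) + exp t / fact (N + 2)"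
    using Maclaurin_exp_le[of 1 "N + 2"] by auto
  define A :: int where "A = (\<Sum>k\<le>N. fact N div fact k)"
  define r where "r = exp t / (real (N + 1) * real (N + 2))"
  have "real_of_int (fact N div fact k) = fact N / fact k" if "k \<le> N" for k
    using that by (simp add: real_of_int_div fact_dvd)
  then have A: "fact N * (\<Sum>k\<le>N. 1 / fact k) = real_of_int A"
    by (simp add: A_def sum_distrib_left)
  have fact_N1: "fact N / fact (N + 1) = 1 / real (N + 1)"
    by (simp add: divide_simps)
  have fact_N2: "fact N / fact (N + 2) = 1 / (real (N + 1) * real (N + 2))"
    by (simp add: divide_simps)
  have split: "(\<Sum>k<N + 2. 1 / fact k :: real) = (\<Sum>k\<le>N. 1 / fact k) + 1 / fact (N + 1)"
    by (simp add: lessThan_Suc_atMost)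
  have "fact N * exp 1 = fact N * (\<Sum>k\<le>N. 1 / fact k) + fact N / fact (N + 1)
      + exp t * (fact N / fact (N + 2))"
    unfolding exp_eq split by (simp only: distrib_left times_divide_eq_right mult_1_right mult.commute)
  then have eq: "fact N * exp 1 = real_of_int A + (1 / real (N + 1) + r)"
    unfolding A fact_N1 fact_N2 r_def by simp
  have "r > 0"
    by (simp add: r_def)
  have "exp t \<le> exp 1"
    using t by simp
  then have "exp t \<le> 3"
    using exp_le by linarith
  \<comment> \<open>With N \<ge> 2, \<open>r\<close> is at most 1/4, and 1/3 + 1/4 + 1/3 = 11/12 < 1
    leaves the required gap below \<open>A + 1\<close>.\<close>
  moreover have "3 * 4 \<le> real (N + 1) * real (N + 2)"
    using assms by (intro mult_mono) auto
  ultimately have "r \<le> 3 / (3 * 4)"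
    unfolding r_def by (intro frac_le) auto
  moreover have "1 / real (N + 1) \<le> 1 / 3"
    using assms by (intro divide_left_mono) auto
  ultimately have "1 / real (N + 1) + r < 1 - 1 / real (N + 1)"
    by linarith
  with eq \<open>r > 0\<close> show thesis
    by (intro that) auto
qed

text \<open>Scaling by \<open>fact N\<close> makes p/q an integer; scaling back turns the gap
  1/(N+1) into 1/(N+1)!.\<close>

lemma exp_1_approx_dvd_fact:
  fixes p q :: int and N :: nat
  assumes "q \<noteq> 0" and "N \<ge> 2" and "q dvd fact N"
  shows "\<bar>exp 1 - real_of_int p / real_of_int q\<bar> > 1 / fact (N + 1)"
proof -
  obtain c where c: "fact N = q * c"
    using assms(3) by (rule dvdE)
  have "(fact N :: real) = real_of_int (fact N)"
    by simp
  also have "\<dots> = real_of_int q * real_of_int c"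
    unfolding c by simp
  finally have int: "fact N * (real_of_int p / real_of_int q) = real_of_int (c * p)"
    using assms(1) by simp
  obtain A s where eq: "fact N * exp 1 = real_of_int A + s"
    and s: "1 / real (N + 1) < s" "s < 1 - 1 / real (N + 1)"
    using fact_times_exp_1[OF assms(2)] by metis
  \<comment> \<open>No integer lies strictly between \<open>A\<close> and \<open>A + 1\<close>: the
    distance is at least \<open>s\<close> if c p \<le> A, and at least \<open>1 - s\<close>
    otherwise.\<close>
  have "1 / real (N + 1) < \<bar>real_of_int A + s - real_of_int (c * p)\<bar>"
  proof (cases "c * p \<le> A")
    case True
    then have "real_of_int (c * p) \<le> real_of_int A"
      by (simp only: of_int_le_iff)
    with s(1) show ?thesis
      by linarith
  next
    case False
    then have "real_of_int (A + 1) \<le> real_of_int (c * p)"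
      by (simp only: of_int_le_iff)
    with s(2) show ?thesis
      by simp
  qed
  also have "\<dots> = \<bar>fact N * (exp 1 - real_of_int p / real_of_int q)\<bar>"
    by (simp only: right_diff_distrib eq int)
  also have "\<dots> = fact N * \<bar>exp 1 - real_of_int p / real_of_int q\<bar>"
    by (simp add: abs_mult)
  finally show ?thesis
    by (simp add: divide_simps mult_ac)
qed

theorem mainTheorem2:
  fixes p q :: int
  assumes "q \<noteq> 0"
  shows "\<bar>exp 1 - real_of_int p / real_of_int q\<bar> > 1 / fact (D q sigma + 2)"
proof -
  have "1 \<le> D q sigma \<and> q dvd (\<Prod>i=1..D q sigma. int (sigma i))"
    unfolding D_def by (rule LeastI_ex) (rule D_sigma_exists[OF assms])
  \<comment> \<open>The product of the first n terms is (n+1)!, hence the shift to N = D + 1; the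
    minimum starting at 1 gives N \<ge> 2.\<close>
  then have "D q sigma + 1 \<ge> 2" and "q dvd fact (D q sigma + 1)"
    unfolding prod_sigma by auto
  from exp_1_approx_dvd_fact[OF assms this] show ?thesis
    by (simp only: add.assoc one_add_one)
qed

end
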